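(* A (Hausdorff) topological space $X$ is $k^*$-metrizable (resp. $k$-metrizable) if and only if $X$ is $\mathrm{cs}^*$-metrizable (resp. $\mathrm{cs}$-metrizable) and all compact subsets of $X$ are sequentially compact.
   Context: All topological spaces are Hausdorff; "map" means continuous function. A subset is precompact if its closure is compact. A map $f:X\to Y$ is proper if $f^{-1}(K)$ is precompact in $X$ for every precompact $K\subset Y$ (equivalently, preimages of compact sets are compact); it is subproper if there is $Z\subset X$ with $f(Z)=Y$ such that $Z\cap f^{-1}(K)$ is precompact in $X$ for every precompact $K\subset Y$. A space is $k$-metrizable (resp. $k^*$-metrizable) if it is the image of a metrizable space under a proper (resp. subproper) map. A section of a map $f:X\to Y$ is a (possibly discontinuous) function $s:Y\to X$ with $f\circ s=\mathrm{id}_Y$. A function $s:Y\to X$ is sequentially continuous if for every convergent sequence $(y_n)$ in $Y$ the sequence $(s(y_n))$ converges in $X$; it is $\mathrm{cs}^*$-continuous if for every convergent sequence $(y_n)$ in $Y$ the sequence $(s(y_n))$ has an accumulation point in $X$ (a point each of whose neighborhoods contains $s(y_n)$ for infinitely many $n$). A space $X$ is $\mathrm{cs}$-metrizable (resp. $\mathrm{cs}^*$-metrizable) if it is the image of a metrizable space $M$ under a map $\pi:M\to X$ having a sequentially continuous (resp. $\mathrm{cs}^*$-continuous) section. A space is sequentially compact if each sequence in it contains a convergent subsequence. *)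

theory Defs
  imports "HOL-Analysis.Analysis"
begin

text \<open>
  Spaces are abstract topologies (carrier \<^term>\<open>topspace X\<close>); functions matter only on the
  carrier. The Hausdorff assumption is not built into the definitions.
\<close>

definition precompact_in :: "'a topology \<Rightarrow> 'a set \<Rightarrow> bool" where
  "precompact_in X S \<longleftrightarrow> S \<subseteq> topspace X \<and> compactin X (X closure_of S)"

text \<open>
  \<^const>\<open>proper_map\<close> of HOL-Analysis means closed with compact fibres, which is a stronger
  condition on a continuous function when \<open>Y\<close> is not a k-space; hence a separate notion.
\<close>

definition precompact_proper_map :: "'a topology \<Rightarrow> 'b topology \<Rightarrow> ('a \<Rightarrow> 'b) \<Rightarrow> bool" where
  "precompact_proper_map X Y f \<longleftrightarrow> continuous_map X Y f \<and>
     (\<forall>K. precompact_in Y K \<longrightarrow> precompact_in X {x \<in> topspace X. f x \<in> K})"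

definition subproper_map :: "'a topology \<Rightarrow> 'b topology \<Rightarrow> ('a \<Rightarrow> 'b) \<Rightarrow> bool" where
  "subproper_map X Y f \<longleftrightarrow> continuous_map X Y f \<and>
     (\<exists>Z \<subseteq> topspace X. f ` Z = topspace Y \<and>
        (\<forall>K. precompact_in Y K \<longrightarrow> precompact_in X {x \<in> Z. f x \<in> K}))"

definition section_of_map :: "'a topology \<Rightarrow> 'b topology \<Rightarrow> ('a \<Rightarrow> 'b) \<Rightarrow> ('b \<Rightarrow> 'a) \<Rightarrow> bool" where
  "section_of_map X Y f s \<longleftrightarrow> s \<in> topspace Y \<rightarrow> topspace X \<and> (\<forall>y \<in> topspace Y. f (s y) = y)"

text \<open>
  \<^const>\<open>limitin\<close> only constrains a sequence eventually, so that all terms lie in the space has to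
  be required separately.
\<close>

definition convergent_seq_in :: "'a topology \<Rightarrow> (nat \<Rightarrow> 'a) \<Rightarrow> bool" where
  "convergent_seq_in X \<sigma> \<longleftrightarrow> range \<sigma> \<subseteq> topspace X \<and> (\<exists>l. limitin X \<sigma> l sequentially)"

definition accumulation_point_in :: "'a topology \<Rightarrow> (nat \<Rightarrow> 'a) \<Rightarrow> 'a \<Rightarrow> bool" where
  "accumulation_point_in X \<sigma> x \<longleftrightarrow>
     x \<in> topspace X \<and> (\<forall>U. openin X U \<and> x \<in> U \<longrightarrow> infinite {n. \<sigma> n \<in> U})"

definition sequentially_continuous_fun :: "'a topology \<Rightarrow> 'b topology \<Rightarrow> ('a \<Rightarrow> 'b) \<Rightarrow> bool" where
  "sequentially_continuous_fun Y X s \<longleftrightarrow> s \<in> topspace Y \<rightarrow> topspace X \<and>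
     (\<forall>\<sigma>. convergent_seq_in Y \<sigma> \<longrightarrow> convergent_seq_in X (s \<circ> \<sigma>))"

definition cs_star_continuous_fun :: "'a topology \<Rightarrow> 'b topology \<Rightarrow> ('a \<Rightarrow> 'b) \<Rightarrow> bool" where
  "cs_star_continuous_fun Y X s \<longleftrightarrow> s \<in> topspace Y \<rightarrow> topspace X \<and>
     (\<forall>\<sigma>. convergent_seq_in Y \<sigma> \<longrightarrow> (\<exists>x. accumulation_point_in X (s \<circ> \<sigma>) x))"

definition sequentially_compact_space :: "'a topology \<Rightarrow> bool" where
  "sequentially_compact_space X \<longleftrightarrow>
     (\<forall>\<sigma> :: nat \<Rightarrow> 'a. range \<sigma> \<subseteq> topspace X \<longrightarrow> (\<exists>r. strict_mono r \<and> convergent_seq_in X (\<sigma> \<circ> r)))"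

text \<open>
  In the next four definitions the metrizable space \<open>M\<close> ranges over topologies on the type
  \<^typ>\<open>nat \<Rightarrow> 'a\<close>, since HOL cannot quantify over types. This is no restriction:
  the lemmas \<open>k_metrizable_spaceI\<close>, \<open>k_star_metrizable_spaceI\<close>, \<open>cs_metrizable_spaceI\<close>,
  \<open>cs_star_metrizable_spaceI\<close> below show that a metrizable space on an arbitrary type serves as
  well. The reason is that \<open>M\<close> can be cut down to the closure of the image of a section, whose
  points are limits of sequences indexed by points of \<open>X\<close>.
\<close>

definition k_metrizable_space :: "'a topology \<Rightarrow> bool" where
  "k_metrizable_space X \<longleftrightarrow> (\<exists>(M :: (nat \<Rightarrow> 'a) topology) f.
     metrizable_space M \<and> f ` topspace M = topspace X \<and> precompact_proper_map M X f)"

definition k_star_metrizable_space :: "'a topology \<Rightarrow> bool" where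
  "k_star_metrizable_space X \<longleftrightarrow> (\<exists>(M :: (nat \<Rightarrow> 'a) topology) f.
     metrizable_space M \<and> f ` topspace M = topspace X \<and> subproper_map M X f)"

definition cs_metrizable_space :: "'a topology \<Rightarrow> bool" where
  "cs_metrizable_space X \<longleftrightarrow> (\<exists>(M :: (nat \<Rightarrow> 'a) topology) \<pi> s.
     metrizable_space M \<and> continuous_map M X \<pi> \<and> \<pi> ` topspace M = topspace X \<and>
     section_of_map M X \<pi> s \<and> sequentially_continuous_fun X M s)"

definition cs_star_metrizable_space :: "'a topology \<Rightarrow> bool" where
  "cs_star_metrizable_space X \<longleftrightarrow> (\<exists>(M :: (nat \<Rightarrow> 'a) topology) \<pi> s.
     metrizable_space M \<and> continuous_map M X \<pi> \<and> \<pi> ` topspace M = topspace X \<and>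
     section_of_map M X \<pi> s \<and> cs_star_continuous_fun X M s)"

lemma section_closure_copy:
  fixes X :: "'a topology" and M :: "'b topology"
  assumes M: "metrizable_space M" and s: "section_of_map M X f s"
  obtains N :: "(nat \<Rightarrow> 'a) topology" and C g h
  where "metrizable_space N" "closedin M C" "s ` topspace X \<subseteq> C"
    "homeomorphic_maps N (subtopology M C) g h"
proof -
  define S where "S = s ` topspace X"
  define C where "C = M closure_of S"
  have SM: "S \<subseteq> topspace M"
    using s by (auto simp: S_def section_of_map_def)
  have SC: "S \<subseteq> C"
    using SM by (simp add: C_def closure_of_subset)
  have CM: "C \<subseteq> topspace M"
    by (simp add: C_def closure_of_subset_topspace)
  have "\<exists>\<sigma>. range \<sigma> \<subseteq> S \<and> limitin M \<sigma> x sequentially" if "x \<in> C" for x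
  proof -
    obtain A d where "Metric_space A d" and Meq: "M = Metric_space.mtopology A d"
      using M by (auto simp: metrizable_space_def)
    then interpret Metric_space A d by simp
    show ?thesis
      using that unfolding C_def Meq closure_of_sequentially by blast
  qed
  then obtain q where q: "\<And>x. x \<in> C \<Longrightarrow> range (q x) \<subseteq> S \<and> limitin M (q x) x sequentially"
    by metis
  define e where "e = (\<lambda>x. f \<circ> q x)"
  have inj: "inj_on e C"
  proof (rule inj_onI)
    fix x y assume x: "x \<in> C" and y: "y \<in> C" and e: "e x = e y"
    have "q x n = q y n" for n
    proof -
      have "q x n \<in> S" "q y n \<in> S" "f (q x n) = f (q y n)"
        using q[OF x] q[OF y] fun_cong[OF e, of n] by (auto simp: e_def)
      then show ?thesis
        using s by (auto simp: S_def section_of_map_def)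
    qed
    then have "q x = q y" by blast
    then show "x = y"
      using q[OF x] q[OF y] metrizable_imp_Hausdorff_space[OF M]
      by (metis limitin_Hausdorff_unique sequentially_bot)
  qed
  define g where "g = inv_into C e"
  define N where "N = pullback_topology (e ` C) g (subtopology M C)"
  have ge: "g (e x) = x" if "x \<in> C" for x
    using that inj by (simp add: g_def)
  have topN: "topspace N = e ` C"
    using CM ge by (auto simp: N_def topspace_pullback_topology)
  have "homeomorphic_maps N (subtopology M C) g e"
    unfolding homeomorphic_maps_def
  proof (intro conjI ballI)
    show "continuous_map N (subtopology M C) g"
      using continuous_map_pullback[of "subtopology M C" "subtopology M C" id "e ` C" g]
      by (simp add: N_def)
    have "continuous_map (subtopology M C) (subtopology M C) (g \<circ> e)"
      using continuous_map_eq[of "subtopology M C" "subtopology M C" id "g \<circ> e"] ge by simp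
    then show "continuous_map (subtopology M C) N e"
      unfolding N_def by (rule continuous_map_pullback') auto
  qed (use topN ge in auto)
  moreover from this have "metrizable_space N"
    using M metrizable_space_subtopology homeomorphic_metrizable_space
      homeomorphic_space_def by metis
  ultimately show ?thesis
    using that[of N C g e] SC by (simp add: C_def S_def)
qed

context
  fixes N :: "'c topology" and M :: "'b topology" and C g h
  assumes C: "closedin M C" and gh: "homeomorphic_maps N (subtopology M C) g h"
begin

lemma closed_copy_basics:
  shows "continuous_map N M g" "\<And>x. x \<in> topspace N \<Longrightarrow> g x \<in> C" "\<And>x. x \<in> topspace N \<Longrightarrow> h (g x) = x"
    "\<And>z. z \<in> C \<Longrightarrow> h z \<in> topspace N" "\<And>z. z \<in> C \<Longrightarrow> g (h z) = z"
    "continuous_map (subtopology M C) N h"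
proof -
  have CM: "C \<subseteq> topspace M" using C by (rule closedin_subset)
  then have top: "topspace (subtopology M C) = C" by auto
  show "continuous_map N M g" "continuous_map (subtopology M C) N h"
    using gh by (auto simp: homeomorphic_maps_def continuous_map_in_subtopology)
  show "\<And>x. x \<in> topspace N \<Longrightarrow> g x \<in> C" "\<And>z. z \<in> C \<Longrightarrow> h z \<in> topspace N"
    using gh top unfolding homeomorphic_maps_def continuous_map_def by blast+
  show "\<And>x. x \<in> topspace N \<Longrightarrow> h (g x) = x" "\<And>z. z \<in> C \<Longrightarrow> g (h z) = z"
    using gh top by (auto simp: homeomorphic_maps_def)
qed

lemma closed_copy_precompact:
  assumes T: "precompact_in M T" and S: "S \<subseteq> topspace N" "g ` S \<subseteq> T"
  shows "precompact_in N S"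
proof -
  have "homeomorphic_map N (subtopology M C) g"
    using gh homeomorphic_map_maps by blast
  then have "closed_map N M g"
    using C closed_map_from_closed_subtopology homeomorphic_imp_closed_map by blast
  moreover have "inj_on g (topspace N)"
    using closed_copy_basics(3) by (metis inj_onI)
  ultimately have p: "proper_map N M g"
    by (rule closed_injective_imp_proper_map)
  let ?K = "{x \<in> topspace N. g x \<in> M closure_of T}"
  have K: "compactin N ?K"
    using compactin_proper_map_preimage[OF p] T by (simp add: precompact_in_def)
  have "closedin N ?K"
    using closed_copy_basics(1) closedin_continuous_map_preimage by fastforce
  moreover have "S \<subseteq> ?K"
    using S T closure_of_subset[of T M] by (auto simp: precompact_in_def image_subset_iff subset_iff)
  ultimately have "N closure_of S \<subseteq> ?K"
    by (rule closure_of_minimal[rotated])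
  then show ?thesis
    using S closed_compactin[OF K] by (simp add: precompact_in_def)
qed

lemma closed_copy_convergent:
  assumes "convergent_seq_in M \<sigma>" "range \<sigma> \<subseteq> C"
  shows "convergent_seq_in N (h \<circ> \<sigma>)"
proof -
  obtain l where l: "limitin M \<sigma> l sequentially"
    using assms by (auto simp: convergent_seq_in_def)
  have "l \<in> C"
    using l C assms(2) by (intro limitin_closedin[OF l C]) (auto simp: image_subset_iff)
  then have "limitin (subtopology M C) \<sigma> l sequentially"
    using l assms(2) by (auto simp: limitin_subtopology image_subset_iff)
  then have "limitin N (h \<circ> \<sigma>) (h l) sequentially"
    by (rule continuous_map_limit[OF closed_copy_basics(6)])
  then show ?thesis
    using assms(2) closed_copy_basics(4) by (auto simp: convergent_seq_in_def)
qed

lemma closed_copy_accumulation: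
  assumes "accumulation_point_in M \<sigma> x" "range \<sigma> \<subseteq> C"
  shows "accumulation_point_in N (h \<circ> \<sigma>) (h x)"
proof -
  have x: "x \<in> topspace M" "\<And>U. openin M U \<Longrightarrow> x \<in> U \<Longrightarrow> infinite {n. \<sigma> n \<in> U}"
    using assms by (auto simp: accumulation_point_in_def)
  have xC: "x \<in> C"
  proof (rule ccontr)
    assume "x \<notin> C"
    then have "infinite {n. \<sigma> n \<in> topspace M - C}"
      using x C by blast
    moreover have "{n. \<sigma> n \<in> topspace M - C} = {}"
      using assms(2) by auto
    ultimately show False by (metis finite.emptyI)
  qed
  have "infinite {n. (h \<circ> \<sigma>) n \<in> U}" if U: "openin N U" "h x \<in> U" for U
  proof -
    have "openin (subtopology M C) {z \<in> topspace (subtopology M C). h z \<in> U}"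
      using closed_copy_basics(6) U(1) openin_continuous_map_preimage by blast
    then obtain V where V: "openin M V" "{z \<in> topspace (subtopology M C). h z \<in> U} = V \<inter> C"
      by (auto simp: openin_subtopology)
    have "x \<in> V" using xC x(1) U(2) V(2) by auto
    then have "infinite {n. \<sigma> n \<in> V}" using x(2) V(1) by blast
    moreover have "{n. \<sigma> n \<in> V} \<subseteq> {n. (h \<circ> \<sigma>) n \<in> U}"
      using assms(2) V(2) by auto
    ultimately show ?thesis by (meson infinite_super)
  qed
  then show ?thesis
    using closed_copy_basics(4)[OF xC] by (auto simp: accumulation_point_in_def)
qed

lemma closed_copy_section:
  assumes s: "section_of_map M X f s" "s ` topspace X \<subseteq> C" and f: "continuous_map M X f"
  shows "section_of_map N X (f \<circ> g) (h \<circ> s)" "continuous_map N X (f \<circ> g)"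
    "(f \<circ> g) ` topspace N = topspace X"
proof -
  show 1: "section_of_map N X (f \<circ> g) (h \<circ> s)"
    using s closed_copy_basics(4,5) by (auto simp: section_of_map_def image_subset_iff)
  show 2: "continuous_map N X (f \<circ> g)"
    using closed_copy_basics(1) f continuous_map_compose by blast
  have "y \<in> (f \<circ> g) ` topspace N" if "y \<in> topspace X" for y
    using 1 that by (intro image_eqI[of _ _ "(h \<circ> s) y"]) (auto simp: section_of_map_def)
  then show "(f \<circ> g) ` topspace N = topspace X"
    using continuous_map_image_subset_topspace[OF 2] by blast
qed

end

lemma k_metrizable_spaceI:
  fixes X :: "'a topology" and M :: "'b topology"
  assumes M: "metrizable_space M" and im: "f ` topspace M = topspace X"
    and f: "precompact_proper_map M X f"
  shows "k_metrizable_space X"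
proof -
  define s where "s = inv_into (topspace M) f"
  have s: "section_of_map M X f s"
    using im by (auto simp: section_of_map_def s_def inv_into_into f_inv_into_f)
  have cont: "continuous_map M X f"
    and pre: "\<And>K. precompact_in X K \<Longrightarrow> precompact_in M {x \<in> topspace M. f x \<in> K}"
    using f by (auto simp: precompact_proper_map_def)
  obtain N :: "(nat \<Rightarrow> 'a) topology" and C g h where N: "metrizable_space N"
    and C: "closedin M C" and sC: "s ` topspace X \<subseteq> C"
    and gh: "homeomorphic_maps N (subtopology M C) g h"
    using section_closure_copy[OF M s] by blast
  note sec = closed_copy_section[OF C gh s sC cont]
  note b = closed_copy_basics[OF C gh]
  have "precompact_in N {x \<in> topspace N. (f \<circ> g) x \<in> K}" if "precompact_in X K" for K
    using b(2) closedin_subset[OF C]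
    by (intro closed_copy_precompact[OF C gh pre[OF that]]) auto
  then have "precompact_proper_map N X (f \<circ> g)"
    using sec by (simp add: precompact_proper_map_def)
  then show ?thesis
    using N sec(3) unfolding k_metrizable_space_def by blast
qed

lemma k_star_metrizable_spaceI:
  fixes X :: "'a topology" and M :: "'b topology"
  assumes M: "metrizable_space M" and im: "f ` topspace M = topspace X"
    and f: "subproper_map M X f"
  shows "k_star_metrizable_space X"
proof -
  obtain Z where Z: "Z \<subseteq> topspace M" "f ` Z = topspace X"
    and cont: "continuous_map M X f"
    and pre: "\<And>K. precompact_in X K \<Longrightarrow> precompact_in M {x \<in> Z. f x \<in> K}"
    using f by (auto simp: subproper_map_def)
  define s where "s = inv_into Z f"
  have sZ: "s y \<in> Z" if "y \<in> topspace X" for y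
    using that Z by (simp add: s_def inv_into_into)
  have s: "section_of_map M X f s"
    using Z sZ by (auto simp: section_of_map_def s_def f_inv_into_f)
  obtain N :: "(nat \<Rightarrow> 'a) topology" and C g h where N: "metrizable_space N"
    and C: "closedin M C" and sC: "s ` topspace X \<subseteq> C"
    and gh: "homeomorphic_maps N (subtopology M C) g h"
    using section_closure_copy[OF M s] by blast
  note sec = closed_copy_section[OF C gh s sC cont]
  note b = closed_copy_basics[OF C gh]
  let ?Z = "(h \<circ> s) ` topspace X"
  have ZN: "?Z \<subseteq> topspace N"
    using sec(1) by (auto simp: section_of_map_def)
  have "(f \<circ> g) ` ?Z = topspace X"
    using sec(1) by (force simp: section_of_map_def image_image)
  moreover have "precompact_in N {x \<in> ?Z. (f \<circ> g) x \<in> K}" if "precompact_in X K" for K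
    using b(5) sC sZ ZN
    by (intro closed_copy_precompact[OF C gh pre[OF that]]) (auto simp: image_subset_iff)
  ultimately have "subproper_map N X (f \<circ> g)"
    unfolding subproper_map_def using sec(2) ZN by blast
  then show ?thesis
    using N sec(3) unfolding k_star_metrizable_space_def by blast
qed

lemma cs_metrizable_spaceI:
  fixes X :: "'a topology" and M :: "'b topology"
  assumes M: "metrizable_space M" and cont: "continuous_map M X \<pi>"
    and s: "section_of_map M X \<pi> s" and cs: "sequentially_continuous_fun X M s"
  shows "cs_metrizable_space X"
proof -
  obtain N :: "(nat \<Rightarrow> 'a) topology" and C g h where N: "metrizable_space N"
    and C: "closedin M C" and sC: "s ` topspace X \<subseteq> C"
    and gh: "homeomorphic_maps N (subtopology M C) g h"
    using section_closure_copy[OF M s] by blast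
  note sec = closed_copy_section[OF C gh s sC cont]
  have "convergent_seq_in N ((h \<circ> s) \<circ> \<sigma>)" if "convergent_seq_in X \<sigma>" for \<sigma>
    using closed_copy_convergent[OF C gh, of "s \<circ> \<sigma>"] that cs sC
    unfolding sequentially_continuous_fun_def convergent_seq_in_def[of X]
    by (auto simp: comp_assoc image_subset_iff convergent_seq_in_def[of X])
  then have "sequentially_continuous_fun X N (h \<circ> s)"
    using sec(1) by (auto simp: sequentially_continuous_fun_def section_of_map_def)
  then show ?thesis
    using N sec unfolding cs_metrizable_space_def by blast
qed

lemma cs_star_metrizable_spaceI:
  fixes X :: "'a topology" and M :: "'b topology"
  assumes M: "metrizable_space M" and cont: "continuous_map M X \<pi>"
    and s: "section_of_map M X \<pi> s" and cs: "cs_star_continuous_fun X M s"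
  shows "cs_star_metrizable_space X"
proof -
  obtain N :: "(nat \<Rightarrow> 'a) topology" and C g h where N: "metrizable_space N"
    and C: "closedin M C" and sC: "s ` topspace X \<subseteq> C"
    and gh: "homeomorphic_maps N (subtopology M C) g h"
    using section_closure_copy[OF M s] by blast
  note sec = closed_copy_section[OF C gh s sC cont]
  have "\<exists>x. accumulation_point_in N ((h \<circ> s) \<circ> \<sigma>) x" if \<sigma>: "convergent_seq_in X \<sigma>" for \<sigma>
  proof -
    obtain x where "accumulation_point_in M (s \<circ> \<sigma>) x"
      using cs \<sigma> by (auto simp: cs_star_continuous_fun_def)
    moreover have "range (s \<circ> \<sigma>) \<subseteq> C"
      using sC \<sigma> by (auto simp: convergent_seq_in_def image_subset_iff)
    ultimately show ?thesis
      using closed_copy_accumulation[OF C gh] by (metis comp_assoc)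
  qed
  then have "cs_star_continuous_fun X N (h \<circ> s)"
    using sec(1) by (auto simp: cs_star_continuous_fun_def section_of_map_def)
  then show ?thesis
    using N sec unfolding cs_star_metrizable_space_def by blast
qed

end

theory Submission
  imports Defs
begin

text \<open>
  All four notions of metrizability see a space only through its convergent sequences and its
  compact sets, and in a metrizable space \<open>M\<close> precompactness is itself sequential: a set is
  precompact exactly when each of its sequences has a subsequence converging in \<open>M\<close>
  (\<open>precompact_in_metrizable_iff\<close>).

  The starred equivalence is a translation along this dictionary. If \<open>f\<close> is subproper with witness
  \<open>Z\<close>, any section with values in \<open>Z\<close> is cs*-continuous, because it maps a convergent sequence, whose
  range is precompact, into a precompact subset of \<open>M\<close>; lifting sequences of a compact set to \<open>Z\<close> in
  the same way yields sequential compactness. Conversely, the image of a cs*-continuous section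
  witnesses subproperness: a sequence in the section over a compact set has a subsequence that
  converges downstairs, so a further one converges upstairs. If the section is even sequentially
  continuous, the limits upstairs stay in its image, so that the map restricted to this image is proper.

  The substantial implication is that a proper image \<open>X\<close> of a metrizable space \<open>M\<close> is
  cs-metrizable. In general no section into \<open>M\<close> itself is sequentially continuous (map the Cantor
  set onto the unit interval), so another metrizable space is needed: the set \<open>X\<close> with a metric that
  has exactly the convergent sequences of \<open>X\<close>, with the identity both as map and as section. This is
  the sequential form of the theorem that perfect images of metrizable spaces are metrizable.
  Declare \<open>x\<close> and \<open>y\<close> to be \<open>n\<close>-close when their fibres come nearer to each other than
  \<open>1 / (n + 1)\<close>. Chains of close points may run along the fibres and connect points far apart, so this
  closeness obeys no uniform triangle inequality; but for a fixed end point \<open>y\<close> compactness of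
  preimages gives a local one: if \<open>x\<close> and \<open>z\<close>, as well as \<open>z\<close> and \<open>y\<close>, are close enough, then
  \<open>x\<close> and \<open>y\<close> are \<open>n\<close>-close. By the classical theorem of Niemytzki and Wilson such a
  symmetric closeness comes from a metric (\<open>metric_of_local_triangle\<close>); the proof follows Frink,
  choosing radii that depend on the point and then taking infima over chains.
\<close>

section \<open>Precompactness and convergent sequences\<close>

lemma precompact_in_subset:
  assumes T: "precompact_in X T" and "S \<subseteq> T"
  shows "precompact_in X S"
proof -
  have "X closure_of S \<subseteq> X closure_of T"
    using \<open>S \<subseteq> T\<close> by (rule closure_of_mono)
  then have "compactin X (X closure_of S)"
    using T unfolding precompact_in_def by (metis closed_compactin closedin_closure_of)
  then show ?thesis
    using T \<open>S \<subseteq> T\<close> unfolding precompact_in_def by blast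
qed

lemma compactin_imp_precompact_in:
  assumes "Hausdorff_space X" "compactin X K"
  shows "precompact_in X K"
  unfolding precompact_in_def closure_of_closedin[OF compactin_imp_closedin[OF assms]]
  using assms(2) compactin_subset_topspace[OF assms(2)] by blast

text \<open>
  The sequences range over \<open>S\<close>, whereas their limits may lie outside \<open>S\<close>. This avoids handling
  the closure in every later argument.
\<close>

lemma precompact_in_metrizable_iff:
  assumes "metrizable_space M"
  shows "precompact_in M S \<longleftrightarrow> S \<subseteq> topspace M \<and>
    (\<forall>\<sigma>::nat \<Rightarrow> 'a. range \<sigma> \<subseteq> S \<longrightarrow> (\<exists>l r. strict_mono r \<and> limitin M (\<sigma> \<circ> r) l sequentially))"
    (is "?L \<longleftrightarrow> ?R")
proof -
  obtain A d where "Metric_space A d" and Meq: "M = Metric_space.mtopology A d"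
    using assms by (auto simp: metrizable_space_def)
  then interpret Metric_space A d by simp
  show ?thesis
  proof
    assume L: ?L
    then have S: "S \<subseteq> A" and K: "compactin mtopology (mtopology closure_of S)"
      by (auto simp: precompact_in_def Meq)
    have "S \<subseteq> mtopology closure_of S"
      using S by (simp add: closure_of_subset)
    then show ?R
      using S K unfolding compactin_sequentially Meq by (metis order_trans topspace_mtopology)
  next
    assume R: ?R
    have "mtopology derived_set_of T \<noteq> {}" if T: "infinite T" "T \<subseteq> S" for T
    proof -
      obtain \<sigma> :: "nat \<Rightarrow> 'a" where \<sigma>: "inj \<sigma>" "range \<sigma> \<subseteq> T"
        using infinite_countable_subset[OF T(1)] by blast
      then obtain l r where r: "strict_mono r" and l: "limitin mtopology (\<sigma> \<circ> r) l sequentially"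
        using R T(2) unfolding Meq by (meson order_trans)
      have inj: "inj (\<sigma> \<circ> r)"
        using \<sigma>(1) r strict_mono_imp_inj_on by (auto intro: inj_compose)
      have "l \<in> mtopology derived_set_of T"
        unfolding in_derived_set_of
      proof (intro conjI allI impI)
        show "l \<in> topspace mtopology" using l by (rule limitin_topspace)
        fix U assume U: "l \<in> U \<and> openin mtopology U"
        then have "\<forall>\<^sub>F n in sequentially. (\<sigma> \<circ> r) n \<in> U"
          using l by (auto simp: limitin_def)
        then obtain N where N: "\<And>n. n \<ge> N \<Longrightarrow> (\<sigma> \<circ> r) n \<in> U"
          by (auto simp: eventually_sequentially)
        have "(\<sigma> \<circ> r) N \<noteq> (\<sigma> \<circ> r) (Suc N)"
          using inj by (metis injD n_not_Suc_n)
        then show "\<exists>y. y \<noteq> l \<and> y \<in> T \<and> y \<in> U"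
          using N[of N] N[of "Suc N"] \<sigma>(2) by (metis comp_apply le_SucI order_refl rangeI subsetD)
      qed
      then show ?thesis by blast
    qed
    then show ?L
      using R unfolding precompact_in_def Meq compact_closure_of_eq_Bolzano_Weierstrass by auto
  qed
qed

lemma accumulation_point_in_metrizable:
  assumes "metrizable_space M" and \<sigma>: "range \<sigma> \<subseteq> topspace M"
  shows "accumulation_point_in M \<sigma> x \<longleftrightarrow> (\<exists>r. strict_mono r \<and> limitin M (\<sigma> \<circ> r) x sequentially)"
proof
  obtain A d where "Metric_space A d" and Meq: "M = Metric_space.mtopology A d"
    using assms by (auto simp: metrizable_space_def)
  then interpret Metric_space A d by simp
  assume acc: "accumulation_point_in M \<sigma> x"
  then have x: "x \<in> A" by (simp add: accumulation_point_in_def Meq)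
  have "\<exists>m>k. \<sigma> m \<in> mball x (inverse (Suc n))" for k n
  proof -
    have "infinite {n'. \<sigma> n' \<in> mball x (inverse (Suc n))}"
      using acc x by (simp add: accumulation_point_in_def Meq del: in_mball)
    then show ?thesis by (simp add: infinite_nat_iff_unbounded del: in_mball)
  qed
  then have "\<exists>r. \<forall>n. \<sigma> (r n) \<in> mball x (inverse (Suc n)) \<and> r n < r (Suc n)"
    by (intro dependent_nat_choice) blast+
  then obtain r where r: "\<And>n. \<sigma> (r n) \<in> mball x (inverse (Suc n))" "strict_mono r"
    by (auto simp: strict_mono_Suc_iff)
  have "limitin mtopology (\<sigma> \<circ> r) x sequentially"
    unfolding limitin_metric
  proof (intro conjI x allI impI)
    fix \<epsilon> :: real assume "0 < \<epsilon>"
    then have "\<forall>\<^sub>F n in sequentially. inverse (real (Suc n)) < \<epsilon>"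
      by (rule Archimedean_eventually_inverse[THEN iffD2])
    then show "\<forall>\<^sub>F n in sequentially. (\<sigma> \<circ> r) n \<in> A \<and> d ((\<sigma> \<circ> r) n) x < \<epsilon>"
      by (rule eventually_mono) (use r(1) commute[of x] in \<open>auto intro: less_trans\<close>)
  qed
  then show "\<exists>r. strict_mono r \<and> limitin M (\<sigma> \<circ> r) x sequentially"
    using r(2) Meq by blast
next
  assume "\<exists>r. strict_mono r \<and> limitin M (\<sigma> \<circ> r) x sequentially"
  then obtain r where r: "strict_mono r" and l: "limitin M (\<sigma> \<circ> r) x sequentially" by blast
  have "infinite {n. \<sigma> n \<in> U}" if U: "openin M U" "x \<in> U" for U
  proof -
    obtain N where N: "\<And>n. n \<ge> N \<Longrightarrow> \<sigma> (r n) \<in> U"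
      using limitinD[OF l U] by (auto simp: eventually_sequentially)
    have "inj_on r {N..}" using r by (rule strict_mono_imp_inj_on)
    then have "infinite (r ` {N..})" by (simp add: finite_image_iff infinite_Ici)
    moreover have "r ` {N..} \<subseteq> {n. \<sigma> n \<in> U}" using N by auto
    ultimately show ?thesis using finite_subset by blast
  qed
  then show "accumulation_point_in M \<sigma> x"
    using limitin_topspace[OF l] by (simp add: accumulation_point_in_def)
qed

lemma sequence_range_precompact:
  assumes "Hausdorff_space X" "range \<sigma> \<subseteq> topspace X" "limitin X \<sigma> l sequentially"
  shows "precompact_in X (range \<sigma>)"
  using compactin_imp_precompact_in[OF assms(1) compactin_sequence_with_limit[OF assms(3) order_refl assms(2)]]
  by (rule precompact_in_subset) auto

text \<open>
  Compact sets of a Hausdorff space are closed, so a limit in \<open>X\<close> automatically belongs to \<open>K\<close>.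
\<close>

lemma sequentially_compact_subtopology:
  assumes X: "Hausdorff_space X" and K: "compactin X K"
  shows "sequentially_compact_space (subtopology X K) \<longleftrightarrow>
    (\<forall>\<sigma>::nat \<Rightarrow> 'a. range \<sigma> \<subseteq> K \<longrightarrow> (\<exists>l r. strict_mono r \<and> limitin X (\<sigma> \<circ> r) l sequentially))"
proof -
  have "(\<exists>r. strict_mono r \<and> convergent_seq_in (subtopology X K) (\<sigma> \<circ> r)) \<longleftrightarrow>
      (\<exists>l r. strict_mono r \<and> limitin X (\<sigma> \<circ> r) l sequentially)"
    if \<sigma>: "range \<sigma> \<subseteq> K" for \<sigma> :: "nat \<Rightarrow> 'a"
  proof -
    have "convergent_seq_in (subtopology X K) (\<sigma> \<circ> r) \<longleftrightarrow> (\<exists>l. limitin X (\<sigma> \<circ> r) l sequentially)" for r :: "nat \<Rightarrow> nat"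
    proof -
      have "range (\<sigma> \<circ> r) \<subseteq> K" using \<sigma> by auto
      then have "l \<in> K" if "limitin X (\<sigma> \<circ> r) l sequentially" for l
        using limitin_closedin[OF that compactin_imp_closedin[OF X K]] by (auto simp: image_subset_iff)
      then show ?thesis
        using \<sigma> compactin_subset_topspace[OF K]
        by (auto simp: convergent_seq_in_def limitin_subtopology image_subset_iff)
    qed
    then show ?thesis by blast
  qed
  moreover have "topspace (subtopology X K) = K"
    using compactin_subset_topspace[OF K] by auto
  ultimately show ?thesis
    unfolding sequentially_compact_space_def by simp
qed

text \<open>
  The common use of properness and subproperness: sequences over a precompact set subconverge
  upstairs, and their images converge to the image of the limit.
\<close>

lemma precompact_preimage_subsequence:
  assumes M: "metrizable_space M" and f: "continuous_map M X f"
    and Z: "precompact_in M {x \<in> Z. f x \<in> K}"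
    and b: "\<And>n::nat. b n \<in> Z" "\<And>n. f (b n) \<in> K"
  obtains r l where "strict_mono r" "limitin M (b \<circ> r) l sequentially"
    "limitin X (f \<circ> b \<circ> r) (f l) sequentially"
proof -
  have "range b \<subseteq> {x \<in> Z. f x \<in> K}" using b by auto
  then obtain l r where r: "strict_mono r" and l: "limitin M (b \<circ> r) l sequentially"
    using conjunct2[OF precompact_in_metrizable_iff[OF M, THEN iffD1, OF Z]] by blast
  then show ?thesis
    using that continuous_map_limit[OF f l] by (simp add: comp_assoc)
qed

section \<open>Sections over compact sets and subproper maps\<close>

lemma k_star_metrizable_imp_compact_imp_sequentially_compact:
  assumes X: "Hausdorff_space X" and "k_star_metrizable_space X" and K: "compactin X K"
  shows "sequentially_compact_space (subtopology X K)"
proof -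
  obtain M :: "(nat \<Rightarrow> 'a) topology" and f Z where M: "metrizable_space M"
    and f: "continuous_map M X f" and im: "f ` Z = topspace X"
    and pre: "\<And>K. precompact_in X K \<Longrightarrow> precompact_in M {x \<in> Z. f x \<in> K}"
    using assms(2) unfolding k_star_metrizable_space_def subproper_map_def by blast
  have "\<exists>l r. strict_mono r \<and> limitin X (\<sigma> \<circ> r) l sequentially"
    if \<sigma>: "range \<sigma> \<subseteq> K" for \<sigma> :: "nat \<Rightarrow> 'a"
  proof -
    have "\<exists>z\<in>Z. f z = \<sigma> n" for n
      using \<sigma> compactin_subset_topspace[OF K] im by (metis imageE rangeI subsetD)
    then obtain b where b: "\<And>n. b n \<in> Z" "\<And>n. f (b n) = \<sigma> n" by metis
    then have "f \<circ> b = \<sigma>" by auto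
    moreover obtain r l where "strict_mono r" "limitin X (f \<circ> b \<circ> r) (f l) sequentially"
      using precompact_preimage_subsequence[OF M f pre[OF compactin_imp_precompact_in[OF X K]], of b]
        b \<sigma> by (metis rangeI subsetD)
    ultimately show ?thesis by metis
  qed
  then show ?thesis
    unfolding sequentially_compact_subtopology[OF X K] by blast
qed

lemma k_star_metrizable_imp_cs_star_metrizable:
  assumes X: "Hausdorff_space X" and "k_star_metrizable_space X"
  shows "cs_star_metrizable_space X"
proof -
  obtain M :: "(nat \<Rightarrow> 'a) topology" and f Z where M: "metrizable_space M"
    and f: "continuous_map M X f" and Z: "Z \<subseteq> topspace M" and im: "f ` Z = topspace X"
    and pre: "\<And>K. precompact_in X K \<Longrightarrow> precompact_in M {x \<in> Z. f x \<in> K}"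
    using assms(2) unfolding k_star_metrizable_space_def subproper_map_def by blast
  define s where "s = inv_into Z f"
  have s: "s y \<in> Z" "f (s y) = y" if "y \<in> topspace X" for y
    using that unfolding s_def im[symmetric] by (rule inv_into_into, rule f_inv_into_f)
  have "\<exists>x. accumulation_point_in M (s \<circ> \<sigma>) x" if conv: "convergent_seq_in X \<sigma>" for \<sigma>
  proof -
    obtain l where ran: "range \<sigma> \<subseteq> topspace X" and l: "limitin X \<sigma> l sequentially"
      using conv by (auto simp: convergent_seq_in_def)
    then have "\<sigma> n \<in> topspace X" for n by auto
    then have *: "(s \<circ> \<sigma>) n \<in> Z" "f ((s \<circ> \<sigma>) n) \<in> range \<sigma>" for n
      using s by auto
    obtain r x where "strict_mono r" "limitin M (s \<circ> \<sigma> \<circ> r) x sequentially"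
      using precompact_preimage_subsequence[of M X f Z "range \<sigma>" "s \<circ> \<sigma>"]
        M f pre[OF sequence_range_precompact[OF X ran l]] * by metis
    moreover have "range (s \<circ> \<sigma>) \<subseteq> topspace M"
      using *(1) Z by blast
    ultimately show ?thesis
      using accumulation_point_in_metrizable[OF M] by blast
  qed
  then have "cs_star_continuous_fun X M s"
    using s Z by (auto simp: cs_star_continuous_fun_def)
  moreover have "section_of_map M X f s"
    using s Z by (auto simp: section_of_map_def)
  ultimately show ?thesis
    by (intro cs_star_metrizable_spaceI[OF M f])
qed

text \<open>
  The common part of both passages from a section to a (sub)proper map. A sequence in the image of
  the section is recovered from its projection, which lies in a compact set and therefore
  subconverges; the kind of continuity of the section then decides what happens upstairs.
\<close>

lemma section_precompact_subsequence:
  fixes \<tau> :: "nat \<Rightarrow> 'b"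
  assumes X: "Hausdorff_space X"
    and seq: "\<And>K. compactin X K \<Longrightarrow> sequentially_compact_space (subtopology X K)"
    and K: "precompact_in X K"
    and s: "section_of_map M X f s" and \<tau>: "\<And>n. \<tau> n \<in> s ` topspace X" "\<And>n. f (\<tau> n) \<in> K"
  obtains r l where "strict_mono r" "range (f \<circ> \<tau> \<circ> r) \<subseteq> topspace X"
    "limitin X (f \<circ> \<tau> \<circ> r) l sequentially" "s \<circ> (f \<circ> \<tau> \<circ> r) = \<tau> \<circ> r"
proof -
  have inverse: "s (f (\<tau> n)) = \<tau> n" for n
    using \<tau>(1)[of n] s by (auto simp: section_of_map_def)
  have cK: "compactin X (X closure_of K)" and KX: "K \<subseteq> topspace X"
    using K by (auto simp: precompact_in_def)
  have "range (f \<circ> \<tau>) \<subseteq> X closure_of K"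
    using \<tau>(2) closure_of_subset[OF KX] by auto
  then obtain l r where r: "strict_mono r" and l: "limitin X (f \<circ> \<tau> \<circ> r) l sequentially"
    using seq[OF cK] unfolding sequentially_compact_subtopology[OF X cK] by blast
  moreover have "range (f \<circ> \<tau> \<circ> r) \<subseteq> topspace X"
    using \<tau>(2) KX by auto
  moreover have "s \<circ> (f \<circ> \<tau> \<circ> r) = \<tau> \<circ> r"
    by (simp add: fun_eq_iff inverse)
  ultimately show ?thesis using that by blast
qed

lemma cs_star_metrizable_imp_k_star_metrizable:
  assumes X: "Hausdorff_space X" and "cs_star_metrizable_space X"
    and seq: "\<And>K. compactin X K \<Longrightarrow> sequentially_compact_space (subtopology X K)"
  shows "k_star_metrizable_space X"
proof -
  obtain M :: "(nat \<Rightarrow> 'a) topology" and f s where M: "metrizable_space M"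
    and f: "continuous_map M X f" and im: "f ` topspace M = topspace X"
    and s: "section_of_map M X f s" and cs: "cs_star_continuous_fun X M s"
    using assms(2) unfolding cs_star_metrizable_space_def by blast
  let ?Z = "s ` topspace X"
  have Z: "?Z \<subseteq> topspace M" and fs: "\<And>y. y \<in> topspace X \<Longrightarrow> f (s y) = y"
    using s by (auto simp: section_of_map_def)
  have "precompact_in M {x \<in> ?Z. f x \<in> K}" if K: "precompact_in X K" for K
    unfolding precompact_in_metrizable_iff[OF M]
  proof (intro conjI allI impI)
    fix \<tau> :: "nat \<Rightarrow> nat \<Rightarrow> 'a" assume \<tau>: "range \<tau> \<subseteq> {x \<in> ?Z. f x \<in> K}"
    then have "\<tau> n \<in> ?Z" "f (\<tau> n) \<in> K" for n
      by blast+
    then obtain r l where r: "strict_mono r" and ran: "range (f \<circ> \<tau> \<circ> r) \<subseteq> topspace X"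
      and l: "limitin X (f \<circ> \<tau> \<circ> r) l sequentially" and eq: "s \<circ> (f \<circ> \<tau> \<circ> r) = \<tau> \<circ> r"
      using section_precompact_subsequence[OF X seq K s] by blast
    have "convergent_seq_in X (f \<circ> \<tau> \<circ> r)"
      using l ran unfolding convergent_seq_in_def by blast
    then obtain x where x: "accumulation_point_in M (\<tau> \<circ> r) x"
      using cs eq unfolding cs_star_continuous_fun_def by metis
    have "range (\<tau> \<circ> r) \<subseteq> topspace M"
      using \<tau> Z by auto
    then obtain q where "strict_mono q" "limitin M (\<tau> \<circ> r \<circ> q) x sequentially"
      using x accumulation_point_in_metrizable[OF M] by blast
    then show "\<exists>l r. strict_mono r \<and> limitin M (\<tau> \<circ> r) l sequentially"
      using strict_mono_o[OF r] by (metis comp_assoc)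
  qed (use Z in blast)
  moreover have "f ` ?Z = topspace X"
    using fs by force
  ultimately have "subproper_map M X f"
    using f Z unfolding subproper_map_def by blast
  then show ?thesis
    using k_star_metrizable_spaceI[OF M im] by blast
qed

lemma k_metrizable_imp_k_star_metrizable:
  fixes X :: "'a topology"
  assumes "k_metrizable_space X"
  shows "k_star_metrizable_space X"
proof -
  obtain M :: "(nat \<Rightarrow> 'a) topology" and f where "metrizable_space M"
    and im: "f ` topspace M = topspace X" and f: "precompact_proper_map M X f"
    using assms unfolding k_metrizable_space_def by blast
  moreover have "subproper_map M X f"
    using f im unfolding precompact_proper_map_def subproper_map_def
    by (intro conjI exI[of _ "topspace M"]) simp_all
  ultimately show ?thesis
    unfolding k_star_metrizable_space_def by blast
qed

lemma limitin_interleave: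
  assumes "limitin X \<sigma> l sequentially"
  shows "limitin X (\<lambda>n. if even n then \<sigma> (n div 2) else l) l sequentially"
  unfolding limitin_def
proof (intro conjI allI impI)
  fix U assume U: "openin X U \<and> l \<in> U"
  then obtain N where N: "\<And>n. n \<ge> N \<Longrightarrow> \<sigma> n \<in> U"
    using assms by (auto simp: limitin_def eventually_sequentially)
  have "(if even n then \<sigma> (n div 2) else l) \<in> U" if "n \<ge> 2 * N" for n
    using that U N[of "n div 2"] by auto
  then show "\<forall>\<^sub>F n in sequentially. (if even n then \<sigma> (n div 2) else l) \<in> U"
    unfolding eventually_sequentially by blast
qed (rule limitin_topspace[OF assms])

text \<open>
  Sequential continuity as defined only asks that images of convergent sequences converge
  \<^emph>\<open>somewhere\<close>. Interleaving the sequence with its limit forces the limit of the images to be the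
  image of the limit.
\<close>

lemma sequentially_continuous_fun_limit:
  assumes M: "Hausdorff_space M" and s: "sequentially_continuous_fun X M s"
    and ran: "range \<sigma> \<subseteq> topspace X" and l: "limitin X \<sigma> l sequentially"
  shows "limitin M (s \<circ> \<sigma>) (s l) sequentially"
proof -
  define \<tau> where "\<tau> n = (if even n then \<sigma> (n div 2) else l)" for n
  have "range \<tau> \<subseteq> topspace X"
    using ran limitin_topspace[OF l] by (auto simp: \<tau>_def)
  moreover have "limitin X \<tau> l sequentially"
    using limitin_interleave[OF l] by (simp add: \<tau>_def[abs_def])
  ultimately have "convergent_seq_in X \<tau>"
    by (auto simp: convergent_seq_in_def)
  then obtain m where m: "limitin M (s \<circ> \<tau>) m sequentially"
    using s unfolding sequentially_continuous_fun_def convergent_seq_in_def[of M] by blast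
  have even: "limitin M (s \<circ> \<tau> \<circ> (\<lambda>n. 2 * n)) m sequentially"
    using m by (intro limitin_subsequence) (auto intro: strict_monoI)
  have odd: "limitin M (s \<circ> \<tau> \<circ> (\<lambda>n. Suc (2 * n))) m sequentially"
    using m by (intro limitin_subsequence) (auto intro: strict_monoI)
  have "s \<circ> \<tau> \<circ> (\<lambda>n. 2 * n) = s \<circ> \<sigma>" "s \<circ> \<tau> \<circ> (\<lambda>n. Suc (2 * n)) = (\<lambda>n. s l)"
    by (auto simp: \<tau>_def)
  moreover have "s l \<in> topspace M"
    using s limitin_topspace[OF l] by (auto simp: sequentially_continuous_fun_def)
  ultimately show ?thesis
    using even odd M limitin_Hausdorff_unique[of M "\<lambda>n. s l" m sequentially "s l"]
    by (simp add: limitin_const_iff)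
qed

text \<open>
  The metrizable space is the image of the section with its subspace topology, not its closure:
  over a compact set the limits of sequences of section values are again section values, so
  precompactness holds already in the image.
\<close>

lemma cs_metrizable_imp_k_metrizable:
  assumes X: "Hausdorff_space X" and "cs_metrizable_space X"
    and seq: "\<And>K. compactin X K \<Longrightarrow> sequentially_compact_space (subtopology X K)"
  shows "k_metrizable_space X"
proof -
  obtain M :: "(nat \<Rightarrow> 'a) topology" and f s where M: "metrizable_space M"
    and f: "continuous_map M X f"
    and s: "section_of_map M X f s" and cs: "sequentially_continuous_fun X M s"
    using assms(2) unfolding cs_metrizable_space_def by blast
  let ?S = "s ` topspace X"
  let ?N = "subtopology M ?S"
  have S: "?S \<subseteq> topspace M" and fs: "\<And>y. y \<in> topspace X \<Longrightarrow> f (s y) = y"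
    using s by (auto simp: section_of_map_def)
  have topN: "topspace ?N = ?S"
    using S by auto
  have N: "metrizable_space ?N"
    using M by (rule metrizable_space_subtopology)
  have "precompact_in ?N {x \<in> topspace ?N. f x \<in> K}" if K: "precompact_in X K" for K
    unfolding precompact_in_metrizable_iff[OF N] topN
  proof (intro conjI allI impI)
    fix \<tau> :: "nat \<Rightarrow> nat \<Rightarrow> 'a" assume \<tau>: "range \<tau> \<subseteq> {x \<in> ?S. f x \<in> K}"
    then have "\<tau> n \<in> ?S" "f (\<tau> n) \<in> K" for n
      by blast+
    then obtain r l where r: "strict_mono r" and ran: "range (f \<circ> \<tau> \<circ> r) \<subseteq> topspace X"
      and l: "limitin X (f \<circ> \<tau> \<circ> r) l sequentially" and eq: "s \<circ> (f \<circ> \<tau> \<circ> r) = \<tau> \<circ> r"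
      using section_precompact_subsequence[OF X seq K s] by blast
    have "limitin M (\<tau> \<circ> r) (s l) sequentially"
      using sequentially_continuous_fun_limit[OF metrizable_imp_Hausdorff_space[OF M] cs ran l] eq by simp
    moreover have "(\<tau> \<circ> r) n \<in> ?S" for n
      using \<tau> by auto
    ultimately have "limitin ?N (\<tau> \<circ> r) (s l) sequentially"
      using limitin_topspace[OF l] by (simp add: limitin_subtopology)
    then show "\<exists>l r. strict_mono r \<and> limitin ?N (\<tau> \<circ> r) l sequentially"
      using r by blast
  qed blast
  moreover have "continuous_map ?N X f"
    using f by (rule continuous_map_from_subtopology)
  ultimately have "precompact_proper_map ?N X f"
    unfolding precompact_proper_map_def by blast
  moreover have "f ` topspace ?N = topspace X"
    unfolding topN using fs by force
  ultimately show ?thesis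
    using k_metrizable_spaceI[OF N] by blast
qed

section \<open>Metrization by a local triangle axiom\<close>

text \<open>
  Frink's chain lemma. Cut the chain at the last index \<open>r\<close> from which the end is still at least half
  of \<open>\<rho> (u a) (u b)\<close> away. From the next index on the end is nearer, so \<open>Suc r\<close> is at least
  half that distance from the start. Hence \<open>\<rho> (u a) (u b)\<close> is at most the sum of the distances
  spanned by two overlapping parts of the chain, \<open>a\<close> to \<open>Suc r\<close> and \<open>r\<close> to \<open>b\<close>. The two
  negative terms make the induction close: the step from \<open>r\<close> to \<open>Suc r\<close> is counted in both parts,
  and the weight \<open>4\<close> of its second copy is paid by the \<open>2\<close> subtracted for it in each part.
\<close>

lemma relaxed_chain_inequality:
  fixes \<rho> :: "'a \<Rightarrow> 'a \<Rightarrow> real"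
  assumes nonneg: "\<And>x y. 0 \<le> \<rho> x y"
    and relaxed: "\<And>x y z. \<rho> x z \<le> 2 * max (\<rho> x y) (\<rho> y z)"
    and "Suc (Suc a) \<le> b"
  shows "\<rho> (u a) (u b) \<le> 4 * (\<Sum>i=a..<b. \<rho> (u i) (u (Suc i)))
           - 2 * \<rho> (u a) (u (Suc a)) - 2 * \<rho> (u (b - 1)) (u b)"
  using \<open>Suc (Suc a) \<le> b\<close>
proof (induction "b - a" arbitrary: a b rule: less_induct)
  case less
  let ?\<sigma> = "\<lambda>i j. \<Sum>k=i..<j. \<rho> (u k) (u (Suc k))"
  let ?L = "\<rho> (u a) (u b)"
  let ?far = "\<lambda>r. a \<le> r \<and> r < b \<and> ?L \<le> 2 * \<rho> (u r) (u b)"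
  have "?far a"
    using less.prems nonneg[of "u a" "u b"] by linarith
  then obtain r where r: "?far r" and r_max: "\<And>k. ?far k \<Longrightarrow> k \<le> r"
    using Nat.ex_has_greatest_nat[of ?far a b] by (metis less_imp_le)
  have ends: "\<rho> (u a) (u (Suc a)) + \<rho> (u (b - 1)) (u b) \<le> ?\<sigma> a b"
  proof -
    have "sum (\<lambda>k. \<rho> (u k) (u (Suc k))) {a, b - 1} \<le> ?\<sigma> a b"
      using less.prems nonneg by (intro sum_mono2) auto
    then show ?thesis
      using less.prems by auto
  qed
  show ?case
  proof (cases "r = b - 1")
    case True
    have "0 \<le> \<rho> (u a) (u (Suc a))" by (rule nonneg)
    then show ?thesis using r ends True by auto
  next
    case False
    then have Suc_r: "Suc r < b" using r by linarith
    then have "\<not> ?L \<le> 2 * \<rho> (u (Suc r)) (u b)"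
      using r_max[of "Suc r"] r by auto
    then have near: "?L \<le> 2 * \<rho> (u a) (u (Suc r))"
      using relaxed[of "u a" "u b" "u (Suc r)"] by linarith
    show ?thesis
    proof (cases "r = a")
      case True
      have "0 \<le> \<rho> (u (b - 1)) (u b)" by (rule nonneg)
      then show ?thesis using near ends True by auto
    next
      case False
      have "\<rho> (u a) (u (Suc r)) \<le> 4 * ?\<sigma> a (Suc r)
          - 2 * \<rho> (u a) (u (Suc a)) - 2 * \<rho> (u r) (u (Suc r))"
        using less.hyps[of "Suc r" a] False r Suc_r by auto
      moreover have "\<rho> (u r) (u b) \<le> 4 * ?\<sigma> r b
          - 2 * \<rho> (u r) (u (Suc r)) - 2 * \<rho> (u (b - 1)) (u b)"
        using less.hyps[of b r] False r Suc_r by auto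
      moreover have "?\<sigma> a r + ?\<sigma> r b = ?\<sigma> a b"
        using r by (intro sum.atLeastLessThan_concat) auto
      moreover have "?\<sigma> a (Suc r) = ?\<sigma> a r + \<rho> (u r) (u (Suc r))"
        using r by simp
      ultimately show ?thesis using near r by argo
    qed
  qed
qed

text \<open>
  The metric is the infimum of the lengths of all chains. The triangle inequality is then
  concatenation of chains, and the chain lemma keeps the infimum from collapsing.
\<close>

lemma metric_of_relaxed_metric:
  fixes \<rho> :: "'a \<Rightarrow> 'a \<Rightarrow> real"
  assumes nonneg: "\<And>x y. 0 \<le> \<rho> x y"
    and sym: "\<And>x y. \<rho> x y = \<rho> y x"
    and zero: "\<And>x y. \<rho> x y = 0 \<longleftrightarrow> x = y"
    and relaxed: "\<And>x y z. \<rho> x z \<le> 2 * max (\<rho> x y) (\<rho> y z)"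
  obtains D where "Metric_space UNIV D" "\<And>x y. D x y \<le> \<rho> x y" "\<And>x y. \<rho> x y \<le> 4 * D x y"
proof
  define len where "len u n = (\<Sum>i<n. \<rho> (u i) (u (Suc i)))" for u :: "nat \<Rightarrow> 'a" and n
  define L where "L x y = {len u n | u n. u 0 = x \<and> u n = y}" for x y
  define D where "D x y = Inf (L x y)" for x y
  have bound: "\<rho> (u 0) (u n) \<le> 4 * len u n" for u n
  proof -
    consider "n = 0" | "n = 1" | "Suc (Suc 0) \<le> n" by linarith
    then show ?thesis
    proof cases
      case 1 then show ?thesis using zero[of "u 0" "u 0"] by (simp add: len_def)
    next
      case 2 then show ?thesis using nonneg[of "u 0" "u 1"] by (simp add: len_def)
    next
      case 3
      have "\<rho> (u 0) (u n) \<le> 4 * (\<Sum>i=0..<n. \<rho> (u i) (u (Suc i)))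
           - 2 * \<rho> (u 0) (u (Suc 0)) - 2 * \<rho> (u (n - 1)) (u n)"
        using nonneg relaxed 3 by (rule relaxed_chain_inequality)
      then show ?thesis
        using nonneg[of "u 0" "u (Suc 0)"] nonneg[of "u (n - 1)" "u n"]
        unfolding len_def lessThan_atLeast0 by linarith
    qed
  qed
  have lower: "\<rho> x y / 4 \<le> l" if "l \<in> L x y" for x y l
    using that unfolding L_def by (auto simp: field_simps intro: order_trans[OF bound])
  have step: "\<rho> x y \<in> L x y" for x y
    unfolding L_def len_def
    by (rule CollectI, rule exI[of _ "\<lambda>i. if i = 0 then x else y"], rule exI[of _ 1]) simp
  have bdd: "bdd_below (L x y)" for x y
    using lower by (meson bdd_belowI)
  show "D x y \<le> \<rho> x y" for x y
    unfolding D_def using step bdd by (rule cInf_lower)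
  show D_lower: "\<rho> x y \<le> 4 * D x y" for x y
  proof -
    have "\<rho> x y / 4 \<le> D x y"
      unfolding D_def using step[of x y] lower by (intro cInf_greatest) auto
    then show ?thesis by simp
  qed
  have rev: "L x y \<subseteq> L y x" for x y
  proof
    fix l assume "l \<in> L x y"
    then obtain u n where u: "l = len u n" "u 0 = x" "u n = y"
      by (auto simp: L_def)
    have "len (\<lambda>i. u (n - i)) n = (\<Sum>i<n. \<rho> (u (n - Suc i)) (u (Suc (n - Suc i))))"
      unfolding len_def by (intro sum.cong refl) (simp add: sym Suc_diff_Suc)
    also have "\<dots> = len u n"
      unfolding len_def by (rule sum.nat_diff_reindex)
    finally show "l \<in> L y x"
      unfolding L_def using u by (intro CollectI exI[of _ "\<lambda>i. u (n - i)"] exI[of _ n]) simp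
  qed
  have concat: "l + m \<in> L x z" if l: "l \<in> L x y" and m: "m \<in> L y z" for l m x y z
  proof -
    obtain u n where u: "l = len u n" "u 0 = x" "u n = y"
      using l by (auto simp: L_def)
    obtain v k where v: "m = len v k" "v 0 = y" "v k = z"
      using m by (auto simp: L_def)
    let ?w = "\<lambda>i. if i \<le> n then u i else v (i - n)"
    have w: "?w (n + i) = v i" for i
      using u v by auto
    have "len ?w (n + k) = (\<Sum>i<n. \<rho> (?w i) (?w (Suc i))) + (\<Sum>i<k. \<rho> (?w (n + i)) (?w (n + Suc i)))"
      unfolding len_def by (induction k) (simp_all add: add.assoc)
    also have "(\<Sum>i<n. \<rho> (?w i) (?w (Suc i))) = len u n"
      unfolding len_def by (intro sum.cong) auto
    also have "(\<Sum>i<k. \<rho> (?w (n + i)) (?w (n + Suc i))) = len v k"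
      unfolding len_def w ..
    finally show ?thesis
      unfolding L_def using u v w[of k] by (intro CollectI exI[of _ ?w] exI[of _ "n + k"]) simp
  qed
  show "Metric_space UNIV D"
  proof
    show "0 \<le> D x y" for x y
      using D_lower[of x y] nonneg[of x y] by simp
    show "D x y = D y x" for x y
      using rev[of x y] rev[of y x] by (simp add: D_def)
    show "D x y = 0 \<longleftrightarrow> x = y" for x y
    proof
      assume "D x y = 0"
      then show "x = y"
        using D_lower[of x y] nonneg[of x y] zero[of x y] by simp
    next
      assume "x = y"
      then have "D x y \<le> 0"
        using \<open>\<And>x y. D x y \<le> \<rho> x y\<close>[of x y] zero[of x y] by simp
      then show "D x y = 0"
        using D_lower[of x y] nonneg[of x y] by simp
    qed
    show "D x z \<le> D x y + D y z" for x y z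
    proof -
      have "D x z - l \<le> D y z" if "l \<in> L x y" for l
        unfolding D_def[of y z]
      proof (rule cInf_greatest)
        fix m assume "m \<in> L y z"
        then show "D x z - l \<le> m"
          using cInf_lower[OF concat[OF \<open>l \<in> L x y\<close>] bdd, of m z] by (simp add: D_def)
      qed (use step in blast)
      then have "D x z - D y z \<le> D x y"
        unfolding D_def[of x y] using step[of x y] by (intro cInf_greatest) (auto simp: algebra_simps)
      then show ?thesis by simp
    qed
  qed
qed

text \<open>
  The relations are the basic entourages of a separated uniformity with a countable base, and the
  lemma is its metrization. The function sending a pair to the smallest \<open>(1/2) ^ k\<close> with
  \<open>R k x y\<close>, or to \<open>0\<close> if no such power is smallest, satisfies the relaxed inequality
  \<open>\<rho> x z \<le> 2 * max (\<rho> x y) (\<rho> y z)\<close>.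
\<close>

lemma metric_of_relation_sequence:
  fixes R :: "nat \<Rightarrow> 'a \<Rightarrow> 'a \<Rightarrow> bool"
  assumes total: "\<And>x y. R 0 x y"
    and refl: "\<And>k x. R k x x"
    and sym: "\<And>k x y. R k x y \<Longrightarrow> R k y x"
    and comp: "\<And>k x y z. R (Suc k) x y \<Longrightarrow> R (Suc k) y z \<Longrightarrow> R k x z"
    and sep: "\<And>x y. (\<And>k. R k x y) \<Longrightarrow> x = y"
  obtains D where "Metric_space UNIV D" "\<And>k x y. R k x y \<Longrightarrow> D x y \<le> (1/2) ^ k"
    "\<And>k x y. D x y < (1/2) ^ k / 4 \<Longrightarrow> R k x y"
proof -
  define P where "P x y = {(1/2::real) ^ k | k. R k x y}" for x y
  define \<rho> where "\<rho> x y = Inf (P x y)" for x y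
  have nonempty: "P x y \<noteq> {}" for x y
    using total by (auto simp: P_def)
  have bdd: "bdd_below (P x y)" for x y
    by (rule bdd_belowI[of _ 0]) (auto simp: P_def)
  have upper: "\<rho> x y \<le> (1/2) ^ k" if "R k x y" for k x y
    unfolding \<rho>_def using that bdd by (intro cInf_lower) (auto simp: P_def)
  have below: "\<exists>k. R k x y \<and> (1/2) ^ k < \<epsilon>" if "\<rho> x y < \<epsilon>" for x y \<epsilon>
    using that cInf_lessD[OF nonempty] unfolding \<rho>_def P_def by blast
  have anti: "R j x y" if "R k x y" "j \<le> k" for j k x y
    using \<open>j \<le> k\<close> \<open>R k x y\<close> by (induction rule: dec_induct) (auto intro: comp[OF _ refl])
  have small: "R k x y" if less: "\<rho> x y < (1/2) ^ k" for k x y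
  proof -
    obtain j where j: "R j x y" "(1/2::real) ^ j < (1/2) ^ k"
      using below[OF less] by blast
    have "k < j"
      using j(2) by (subst (asm) power_strict_decreasing_iff) auto
    then show ?thesis using anti[OF j(1)] by simp
  qed
  have nonneg: "0 \<le> \<rho> x y" for x y
    unfolding \<rho>_def using nonempty by (intro cInf_greatest) (auto simp: P_def)
  have double: "\<rho> x z < 2 * \<epsilon>" if xy: "\<rho> x y < \<epsilon>" and yz: "\<rho> y z < \<epsilon>" for x y z \<epsilon>
  proof -
    obtain i where i: "R i x y" "(1/2) ^ i < \<epsilon>"
      using below[OF xy] by blast
    obtain j where j: "R j y z" "(1/2) ^ j < \<epsilon>"
      using below[OF yz] by blast
    define m where "m = min i j"
    have m: "R m x y" "R m y z" "(1/2) ^ m < \<epsilon>"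
      using anti[OF i(1), of m] anti[OF j(1), of m] i(2) j(2) by (auto simp: m_def min_def)
    show ?thesis
    proof (cases m)
      case 0
      then show ?thesis using upper[OF total[of x z]] m(3) by simp
    next
      case (Suc k)
      then have "\<rho> x z \<le> (1/2) ^ k"
        using comp m upper by blast
      then show ?thesis using Suc m(3) by simp
    qed
  qed
  have relaxed: "\<rho> x z \<le> 2 * max (\<rho> x y) (\<rho> y z)" for x y z
    using double[of x y "\<rho> x z / 2" z] by linarith
  have zero: "\<rho> x y = 0 \<longleftrightarrow> x = y" for x y
  proof
    assume "\<rho> x y = 0"
    then show "x = y" using small sep by simp
  next
    assume "x = y"
    have "\<rho> x y < \<epsilon>" if "0 < \<epsilon>" for \<epsilon> :: real
    proof -
      obtain k where "(1/2) ^ k < \<epsilon>"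
        using \<open>0 < \<epsilon>\<close> real_arch_pow_inv[of \<epsilon> "1/2"] by auto
      then show ?thesis using upper[OF refl, of x k] \<open>x = y\<close> by auto
    qed
    then show "\<rho> x y = 0"
      using nonneg[of x y] by (metis less_le not_le less_irrefl)
  qed
  have "\<rho> x y = \<rho> y x" for x y
    unfolding \<rho>_def P_def using sym by metis
  then obtain D where D: "Metric_space UNIV D" "\<And>x y. D x y \<le> \<rho> x y" "\<And>x y. \<rho> x y \<le> 4 * D x y"
    using metric_of_relaxed_metric[OF nonneg _ zero relaxed] by metis
  show thesis
  proof
    show "D x y \<le> (1/2) ^ k" if "R k x y" for k x y
      using D(2) upper[OF that] by (rule order_trans)
    show "R k x y" if "D x y < (1/2) ^ k / 4" for k x y
      using small[of x y k] D(3)[of x y] that by simp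
  qed (rule D(1))
qed

text \<open>
  Read \<open>V n x y\<close> as ``\<open>x\<close> is \<open>n\<close>-close to \<open>y\<close>''. In the hypothesis \<open>local\<close> the index
  \<open>m\<close> depends on the point \<open>y\<close>, so the \<open>V n\<close> need not form a base of a uniformity. Frink's
  remedy is to give every point \<open>w\<close> its own nondecreasing sequence of indices \<open>c w k\<close> and to call
  two points \<open>k\<close>-related when they lie in a common neighbourhood \<open>{x. V (c w k) x w}\<close>. When two
  such neighbourhoods of level \<open>Suc k\<close> meet, the centre with the smaller index absorbs both at level
  \<open>k\<close>, which is the composition law required for a uniformity.

  The conclusion says that the metric and the \<open>V n\<close> have the same neighbourhoods at each point; no
  uniform comparison holds.
\<close>

lemma metric_of_local_triangle:
  fixes V :: "nat \<Rightarrow> 'a \<Rightarrow> 'a \<Rightarrow> bool"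
  assumes refl: "\<And>n x. V n x x"
    and sym: "\<And>n x y. V n x y \<Longrightarrow> V n y x"
    and anti: "\<And>m n x y. m \<le> n \<Longrightarrow> V n x y \<Longrightarrow> V m x y"
    and sep: "\<And>x y. (\<And>n. V n x y) \<Longrightarrow> x = y"
    and local: "\<And>n y. \<exists>m. \<forall>x z. V m x z \<longrightarrow> V m z y \<longrightarrow> V n x y"
  obtains D where "Metric_space UNIV D"
    "\<And>y n. \<exists>\<epsilon>>0. \<forall>x. D x y < \<epsilon> \<longrightarrow> V n x y"
    "\<And>y \<epsilon>. 0 < \<epsilon> \<Longrightarrow> \<exists>n. \<forall>x. V n x y \<longrightarrow> D x y < \<epsilon>"
proof -
  define t where "t y n = (SOME m. \<forall>x z. V m x z \<longrightarrow> V m z y \<longrightarrow> V n x y)" for y n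
  have t: "V n x y" if "V (t y n) x z" "V (t y n) z y" for n x y z
    using someI_ex[OF local] that unfolding t_def by blast
  \<comment> \<open>Two applications of the local triangle axiom at \<open>y\<close>: first to get from \<open>x\<close> via \<open>z\<close> to
    \<open>y\<close>, then from \<open>w\<close> via \<open>x\<close> to \<open>y\<close>.\<close>
  define m where "m y n = max (t y n) (t y (t y n))" for y n
  have absorb: "V n w y" if "V (m y n) w x" "V (m y n) z x" "V (m y n) z y" for n w x y z
  proof -
    have le: "t y n \<le> m y n" "t y (t y n) \<le> m y n"
      by (simp_all add: m_def)
    have "V (t y (t y n)) x z" "V (t y (t y n)) z y" "V (t y n) w x"
      using anti[OF le(2) sym[OF that(2)]] anti[OF le(2) that(3)] anti[OF le(1) that(1)] .
    then show ?thesis using t by blast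
  qed
  define c where "c y k = rec_nat 0 (\<lambda>k n. max (m y n) (max n k)) k" for y k
  have c_Suc: "c y (Suc k) = max (m y (c y k)) (max (c y k) k)" for y k
    by (simp add: c_def)
  define W where "W k w x \<longleftrightarrow> V (c w k) x w" for k w x
  define R where "R k x y \<longleftrightarrow> k = 0 \<or> (\<exists>w. W k w x \<and> W k w y)" for k x y
  have W_anti: "W k w x" if "W (Suc k) w x" for k w x
    using that anti[of "c w k" "c w (Suc k)"] by (auto simp: W_def c_Suc)
  have merge: "W k v x" if le: "c v (Suc k) \<le> c w (Suc k)"
    and y: "W (Suc k) w y" "W (Suc k) v y" and x: "W (Suc k) w x" for k v w x y
  proof -
    have le': "m v (c v k) \<le> c v (Suc k)" by (simp add: c_Suc)
    note c_le = order_trans[OF le' le]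
    show ?thesis
      unfolding W_def
      using absorb anti[OF c_le x[unfolded W_def]] anti[OF c_le y(1)[unfolded W_def]]
        anti[OF le' y(2)[unfolded W_def]] by blast
  qed
  \<comment> \<open>Points related to \<open>y\<close> at a high level are \<open>n\<close>-close to \<open>y\<close>: at level \<open>Suc k\<close> every centre
    has index at least \<open>k\<close>, so the common neighbourhood is small as measured from \<open>y\<close>.\<close>
  have star: "V n x y" if k: "m y n \<le> k" and R: "R (Suc k) x y" for n k x y
  proof -
    obtain w where w: "W (Suc k) w x" "W (Suc k) w y"
      using R by (auto simp: R_def)
    have "m y n \<le> c w (Suc k)"
      using k by (simp add: c_Suc)
    then show ?thesis
      using absorb anti[OF _ w(1)[unfolded W_def]] anti[OF _ w(2)[unfolded W_def]] refl by blast
  qed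
  have "R k x z" if xy: "R (Suc k) x y" and yz: "R (Suc k) y z" for k x y z
  proof -
    obtain w where w: "W (Suc k) w x" "W (Suc k) w y"
      using xy by (auto simp: R_def)
    obtain v where v: "W (Suc k) v y" "W (Suc k) v z"
      using yz by (auto simp: R_def)
    consider "c v (Suc k) \<le> c w (Suc k)" | "c w (Suc k) \<le> c v (Suc k)" by linarith
    then have "(W k v x \<and> W k v z) \<or> (W k w x \<and> W k w z)"
      using merge w v W_anti by cases metis+
    then show ?thesis by (auto simp: R_def)
  qed
  moreover have "x = y" if "\<And>k. R k x y" for x y
    using sep star that by blast
  moreover have R_refl: "R k x x" and R_sym: "R k x y \<Longrightarrow> R k y x" and "R 0 x y" for k x y
    using refl by (auto simp: R_def W_def)
  ultimately obtain D where D: "Metric_space UNIV D" "\<And>k x y. R k x y \<Longrightarrow> D x y \<le> (1/2) ^ k"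
    "\<And>k x y. D x y < (1/2) ^ k / 4 \<Longrightarrow> R k x y"
    using metric_of_relation_sequence[of R] by blast
  show thesis
  proof
    show "\<exists>\<epsilon>>0. \<forall>x. D x y < \<epsilon> \<longrightarrow> V n x y" for y n
      using D(3) star[OF order_refl] by (intro exI[of _ "(1/2) ^ Suc (m y n) / 4"]) auto
    show "\<exists>n. \<forall>x. V n x y \<longrightarrow> D x y < \<epsilon>" if "0 < \<epsilon>" for y \<epsilon>
    proof -
      obtain k where k: "(1/2) ^ k < \<epsilon>"
        using \<open>0 < \<epsilon>\<close> real_arch_pow_inv[of \<epsilon> "1/2"] by auto
      have "R k x y" if "V (c y k) x y" for x
        using that refl by (auto simp: R_def W_def)
      then show ?thesis using D(2) k by (meson le_less_trans)
    qed
  qed (rule D(1))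
qed

section \<open>The sequential metric on a proper image of a metrizable space\<close>

text \<open>
  The bound is by the index in the full sequence, and still tends to zero along the subsequence.
\<close>

lemma (in Metric_space) limitin_vanishing_distance:
  assumes r: "strict_mono r" and l: "limitin mtopology (a \<circ> r) l sequentially"
    and a: "\<And>n::nat. a n \<in> M" and b: "\<And>n. b n \<in> M"
    and ab: "\<And>n. d (a n) (b n) < inverse (real (Suc n))"
  shows "limitin mtopology (b \<circ> r) l sequentially"
  unfolding limitin_metric
proof (intro conjI allI impI)
  show lM: "l \<in> M" using l by (rule limitin_mspace)
  fix \<epsilon> :: real assume "0 < \<epsilon>"
  then have "\<forall>\<^sub>F n in sequentially. d ((a \<circ> r) n) l < \<epsilon> / 2"
    using l half_gt_zero[of \<epsilon>] unfolding limitin_metric by (blast intro: eventually_mono)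
  moreover have "\<forall>\<^sub>F n in sequentially. inverse (real (Suc n)) < \<epsilon> / 2"
    using \<open>0 < \<epsilon>\<close> by (intro Archimedean_eventually_inverse[THEN iffD2]) simp
  ultimately show "\<forall>\<^sub>F n in sequentially. (b \<circ> r) n \<in> M \<and> d ((b \<circ> r) n) l < \<epsilon>"
  proof eventually_elim
    case (elim n)
    have "inverse (real (Suc (r n))) \<le> inverse (real (Suc n))"
      using seq_suble[OF r, of n] by (simp add: le_imp_inverse_le)
    then have "d (a (r n)) (b (r n)) < \<epsilon> / 2"
      using ab[of "r n"] elim by linarith
    then show ?case
      using triangle''[OF b[of "r n"] a[of "r n"] lM] elim b by simp
  qed
qed

text \<open>
  The identity from the metric space to \<open>X\<close> is continuous and conversely every convergent sequence
  of \<open>X\<close> converges in the metric, so the metric has exactly the convergent sequences of \<open>X\<close>. Its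
  topology is in general strictly finer than that of \<open>X\<close>.
\<close>

lemma proper_image_sequential_metric:
  fixes X :: "'a topology" and M :: "'b topology"
  assumes X: "Hausdorff_space X" and M: "metrizable_space M"
    and im: "f ` topspace M = topspace X" and f: "precompact_proper_map M X f"
  obtains D where "Metric_space (topspace X) D"
    "continuous_map (Metric_space.mtopology (topspace X) D) X id"
    "\<And>\<sigma> y. range \<sigma> \<subseteq> topspace X \<Longrightarrow> limitin X \<sigma> y sequentially
       \<Longrightarrow> limitin (Metric_space.mtopology (topspace X) D) \<sigma> y sequentially"
proof -
  obtain A d where "Metric_space A d" and Meq: "M = Metric_space.mtopology A d"
    using M by (auto simp: metrizable_space_def)
  then interpret A: Metric_space A d by simp
  have topM: "topspace M = A" by (simp add: Meq)
  have cont: "continuous_map M X f"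
    and pre: "\<And>K. precompact_in X K \<Longrightarrow> precompact_in M {x \<in> topspace M. f x \<in> K}"
    using f by (auto simp: precompact_proper_map_def)
  have fX: "f a \<in> topspace X" if "a \<in> A" for a
    using that im topM by blast
  have unique: "l = l'" if "limitin X \<sigma> l sequentially" "limitin X \<sigma> l' sequentially" for \<sigma> l l'
    using limitin_Hausdorff_unique[OF that _ X] by simp
  \<comment> \<open>A convergent sequence together with its chosen preimages lives over a precompact set, so the
    preimages subconverge, and necessarily to a point of the fibre over the limit.\<close>
  have lift: "\<exists>r l. strict_mono r \<and> limitin A.mtopology (b \<circ> r) l sequentially \<and> l \<in> A \<and> f l = y"
    if b: "\<And>n. b n \<in> A" and y: "limitin X (f \<circ> b) y sequentially" for b y
  proof -
    have ran: "range (f \<circ> b) \<subseteq> topspace X"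
      using b fX by auto
    have "b n \<in> topspace M" "f (b n) \<in> range (f \<circ> b)" for n
      using b topM by auto
    then obtain r l where r: "strict_mono r" and l: "limitin M (b \<circ> r) l sequentially"
      "limitin X (f \<circ> b \<circ> r) (f l) sequentially"
      using precompact_preimage_subsequence[of M X f "topspace M" "range (f \<circ> b)" b]
        M cont pre[OF sequence_range_precompact[OF X ran y]] by metis
    have "f l = y"
      using l(2) limitin_subsequence[OF r y] by (rule unique)
    moreover have "l \<in> A" using limitin_topspace[OF l(1)] topM by simp
    ultimately show ?thesis using r l(1) Meq by blast
  qed
  have image: "limitin X (f \<circ> b) (f l) sequentially" if "limitin A.mtopology b l sequentially" for b l
    using continuous_map_limit[OF cont] that Meq by blast
  have near: "\<exists>r l. strict_mono r \<and> limitin A.mtopology (a \<circ> r) l sequentially \<and> l \<in> A \<and> f l = y"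
    if ab: "\<And>n. a n \<in> A" "\<And>n. b n \<in> A" "\<And>n. d (a n) (b n) < inverse (real (Suc n))"
      and y: "limitin X (f \<circ> b) y sequentially" for a b y
  proof -
    obtain r l where r: "strict_mono r" "limitin A.mtopology (b \<circ> r) l sequentially" "l \<in> A" "f l = y"
      using lift[OF ab(2) y] by blast
    have ba: "d (b n) (a n) < inverse (real (Suc n))" for n
      using ab(3)[of n] A.commute by simp
    have "limitin A.mtopology (a \<circ> r) l sequentially"
      using r(1,2) ab(2,1) ba by (rule A.limitin_vanishing_distance)
    then show ?thesis
      using r by blast
  qed
  have near_fibre: "\<exists>r. strict_mono r \<and> limitin X (f \<circ> a \<circ> r) y sequentially"
    if ab: "\<And>n. a n \<in> A" "\<And>n. b n \<in> A" "\<And>n. d (a n) (b n) < inverse (real (Suc n))"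
      and y: "\<And>n. f (b n) = y" for a b y
  proof -
    have "f \<circ> b = (\<lambda>n. y)" using y by auto
    moreover have "y \<in> topspace X" using fX[OF ab(2)] y by simp
    ultimately have "limitin X (f \<circ> b) y sequentially"
      by (simp add: limitin_const_iff)
    then obtain r l where r: "strict_mono r" "limitin A.mtopology (a \<circ> r) l sequentially" "f l = y"
      using near[of a b y] ab by blast
    then show ?thesis
      using image[OF r(2)] by (auto simp: comp_assoc)
  qed
  have eventually_close: "\<exists>k. d (a k) l < inverse (real (Suc n))"
    if l: "limitin A.mtopology a l sequentially" for a l n
  proof -
    have "0 < inverse (real (Suc n))" by simp
    then have "\<exists>N. \<forall>k\<ge>N. a k \<in> A \<and> d (a k) l < inverse (real (Suc n))"
      using l unfolding A.limit_metric_sequentially by blast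
    then show ?thesis by blast
  qed
  \<comment> \<open>The alternative \<open>x = y\<close> makes the relation reflexive on the whole type, so that the
    metrization applies there; the points outside \<open>X\<close> are discarded afterwards.\<close>
  define V where "V n x y \<longleftrightarrow> x = y \<or>
    (\<exists>a\<in>A. \<exists>b\<in>A. f a = x \<and> f b = y \<and> d a b < inverse (real (Suc n)))" for n x y
  have V_close: "V n (f a) (f b)" if "a \<in> A" "b \<in> A" "d a b < inverse (real (Suc n))" for n a b
    using that by (auto simp: V_def)
  have V_seq: "\<exists>a b. (\<forall>n. a n \<in> A) \<and> (\<forall>n. b n \<in> A) \<and> (\<forall>n. f (a n) = x n) \<and> (\<forall>n. f (b n) = y n)
      \<and> (\<forall>n. d (a n) (b n) < inverse (real (Suc n)))"
    if "\<And>n. V n (x n) (y n)" "\<And>n. x n \<noteq> y n" for x y :: "nat \<Rightarrow> 'a"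
  proof -
    have "\<forall>n. \<exists>a b. a \<in> A \<and> b \<in> A \<and> f a = x n \<and> f b = y n \<and> d a b < inverse (real (Suc n))"
      using that unfolding V_def by blast
    then show ?thesis by metis
  qed
  have V_anti: "V m x y" if "m \<le> n" "V n x y" for m n x y
  proof -
    have "inverse (real (Suc n)) \<le> inverse (real (Suc m))"
      using \<open>m \<le> n\<close> by (simp add: le_imp_inverse_le)
    then show ?thesis
      using \<open>V n x y\<close> unfolding V_def by (meson less_le_trans)
  qed
  have V_refl: "V n x x" for n x
    by (simp add: V_def)
  have V_sym: "V n y x" if "V n x y" for n x y
    using that A.commute unfolding V_def by metis
  have V_limit: "\<exists>r. strict_mono r \<and> limitin X (x \<circ> r) y sequentially"
    if V: "\<And>n. V n (x n) y" "\<And>n. x n \<noteq> y" for x y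
  proof -
    obtain a b where ab: "\<And>n. a n \<in> A" "\<And>n. b n \<in> A" "\<And>n. f (a n) = x n" "\<And>n. f (b n) = y"
      "\<And>n. d (a n) (b n) < inverse (real (Suc n))"
      using V_seq[of x "\<lambda>n. y"] V by blast
    moreover have "f \<circ> a = x" using ab(3) by auto
    ultimately show ?thesis using near_fibre[of a b y] by simp
  qed
  have sep: "x = y" if V: "\<And>n. V n x y" for x y
  proof (rule ccontr)
    assume "x \<noteq> y"
    then obtain r :: "nat \<Rightarrow> nat" where "limitin X ((\<lambda>n. x) \<circ> r) y sequentially"
      using V_limit[of "\<lambda>n. x" y] V by blast
    moreover have "x \<in> topspace X"
      using V[of 0] \<open>x \<noteq> y\<close> fX by (auto simp: V_def)
    then have "limitin X ((\<lambda>n. x) \<circ> r) x sequentially"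
      by (simp add: limitin_const_iff comp_def)
    ultimately show False
      using unique \<open>x \<noteq> y\<close> by metis
  qed
  have local: "\<exists>m. \<forall>x z. V m x z \<longrightarrow> V m z y \<longrightarrow> V n x y" for n y
  proof (rule ccontr)
    assume "\<not> ?thesis"
    then have "\<forall>m. \<exists>x z. V (m + n) x z \<and> V (m + n) z y \<and> \<not> V n x y" by blast
    then obtain x z where V: "\<And>m. V (m + n) (x m) (z m)" "\<And>m. V (m + n) (z m) y"
      and not_V: "\<And>m. \<not> V n (x m) y"
      by metis
    \<comment> \<open>A degenerate link would make \<open>x m\<close> directly close to \<open>y\<close>; the shift of the index by \<open>n\<close>
      in the choice of \<open>x\<close> and \<open>z\<close> excludes this.\<close>
    have ne: "x m \<noteq> z m" "z m \<noteq> y" for m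
      using V[of m] not_V[of m] V_anti[of n "m + n"] by auto
    have V': "V m (x m) (z m)" "V m (z m) y" for m
      using V V_anti[of m "m + n"] by auto
    obtain r :: "nat \<Rightarrow> nat" where r: "strict_mono r" "limitin X (z \<circ> r) y sequentially"
      using V_limit[of z y] V'(2) ne(2) by blast
    have "V m (x (r m)) (z (r m))" for m
      using V'(1)[of "r m"] V_anti[OF seq_suble[OF r(1)]] by blast
    then obtain a b where ab: "\<And>m. a m \<in> A" "\<And>m. b m \<in> A" "\<And>m. f (a m) = x (r m)"
      "\<And>m. f (b m) = z (r m)" "\<And>m. d (a m) (b m) < inverse (real (Suc m))"
      using V_seq[of "\<lambda>m. x (r m)" "\<lambda>m. z (r m)"] ne(1) by blast
    \<comment> \<open>Now \<open>z \<circ> r\<close> converges to \<open>y\<close>, so its lift \<open>b\<close> and the neighbouring lift \<open>a\<close> of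
      \<open>x \<circ> r\<close> subconverge to the fibre over \<open>y\<close>.\<close>
    have "f \<circ> b = z \<circ> r" using ab(4) by auto
    then obtain q l where q: "limitin A.mtopology (a \<circ> q) l sequentially" "l \<in> A" "f l = y"
      using near[of a b y] ab r(2) by auto
    then obtain k where "d (a (q k)) l < inverse (real (Suc n))"
      using eventually_close[OF q(1), of n] by auto
    then have "V n (x (r (q k))) y"
      using V_close[OF ab(1) q(2)] ab(3) q(3) by metis
    then show False using not_V by blast
  qed
  obtain D where UD: "Metric_space UNIV D"
    and D_V: "\<And>y n. \<exists>\<epsilon>>0. \<forall>x. D x y < \<epsilon> \<longrightarrow> V n x y"
    and V_D: "\<And>y \<epsilon>. 0 < \<epsilon> \<Longrightarrow> \<exists>n. \<forall>x. V n x y \<longrightarrow> D x y < \<epsilon>"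
    by (rule metric_of_local_triangle[of V])
      (rule V_refl, erule V_sym, erule (1) V_anti, rule sep, blast, rule local, rule that)
  have MD: "Metric_space (topspace X) D"
    using Metric_space.subspace[OF UD subset_UNIV] .
  then interpret D: Metric_space "topspace X" D .
  have nbhd: "\<exists>n. \<forall>x. V n x y \<longrightarrow> x \<in> U" if U: "openin X U" "y \<in> U" for U y
  proof (rule ccontr)
    assume "\<not> ?thesis"
    then have "\<forall>n. \<exists>x. V n x y \<and> x \<notin> U" by blast
    then obtain x where x: "\<And>n. V n (x n) y" "\<And>n. x n \<notin> U" by metis
    have "x n \<noteq> y" for n using x(2)[of n] U(2) by auto
    then obtain r :: "nat \<Rightarrow> nat" where "limitin X (x \<circ> r) y sequentially"
      using V_limit[of x y] x(1) by blast
    then have "\<forall>\<^sub>F n in sequentially. x (r n) \<in> U"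
      using limitinD[of X "x \<circ> r", OF _ U] by simp
    then show False using x(2) by (simp add: eventually_sequentially)
  qed
  show thesis
  proof
    show "continuous_map D.mtopology X id"
      unfolding continuous_map_def
    proof (intro conjI allI impI)
      fix U assume U: "openin X U"
      have "\<exists>r>0. D.mball y r \<subseteq> U" if "y \<in> U" for y
      proof -
        obtain n where n: "\<And>x. V n x y \<Longrightarrow> x \<in> U" using nbhd[OF U \<open>y \<in> U\<close>] by blast
        obtain \<epsilon> where "\<epsilon> > 0" "\<And>x. D x y < \<epsilon> \<Longrightarrow> V n x y" using D_V by blast
        then show ?thesis
          using n D.commute by (intro exI[of _ \<epsilon>]) auto
      qed
      moreover have "{x \<in> topspace D.mtopology. id x \<in> U} = U"
        using openin_subset[OF U] by auto
      ultimately show "openin D.mtopology {x \<in> topspace D.mtopology. id x \<in> U}"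
        using openin_subset[OF U] by (simp add: D.openin_mtopology)
    qed simp
  next
    fix \<sigma> y assume \<sigma>: "range \<sigma> \<subseteq> topspace X" and y: "limitin X \<sigma> y sequentially"
    have ev: "\<forall>\<^sub>F k in sequentially. V n (\<sigma> k) y" for n
    proof (rule ccontr)
      assume "\<not> ?thesis"
      then have "infinite {k. \<not> V n (\<sigma> k) y}"
        by (auto simp: eventually_sequentially infinite_nat_iff_unbounded_le)
      then obtain r :: "nat \<Rightarrow> nat" where r: "strict_mono r" "\<And>k. \<not> V n (\<sigma> (r k)) y"
        using infinite_enumerate by blast
      have "\<exists>a\<in>A. f a = \<sigma> (r k)" for k
        using \<sigma> im topM by (metis imageE rangeI subsetD)
      then obtain a where a: "\<And>k. a k \<in> A" "\<And>k. f (a k) = \<sigma> (r k)" by metis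
      have "f \<circ> a = \<sigma> \<circ> r" using a by auto
      then have "limitin X (f \<circ> a) y sequentially"
        using limitin_subsequence[OF r(1) y] by simp
      then obtain q l where q: "limitin A.mtopology (a \<circ> q) l sequentially" "l \<in> A" "f l = y"
        using lift[of a y] a(1) by blast
      obtain k where "d (a (q k)) l < inverse (real (Suc n))"
        using eventually_close[OF q(1), of n] by auto
      then have "V n (\<sigma> (r (q k))) y"
        using V_close[OF a(1) q(2)] a(2) q(3) by metis
      then show False using r(2) by blast
    qed
    have "\<forall>\<^sub>F k in sequentially. D (\<sigma> k) y < \<epsilon>" if \<epsilon>: "0 < \<epsilon>" for \<epsilon>
    proof -
      obtain n where n: "\<And>x. V n x y \<Longrightarrow> D x y < \<epsilon>" using V_D[OF \<epsilon>, of y] by blast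
      show ?thesis using ev n by (rule eventually_mono)
    qed
    then show "limitin D.mtopology \<sigma> y sequentially"
      unfolding D.limitin_metric using \<sigma> limitin_topspace[OF y]
      by (auto simp: image_subset_iff)
  qed (rule MD)
qed

lemma k_metrizable_imp_cs_metrizable:
  fixes X :: "'a topology"
  assumes X: "Hausdorff_space X" and "k_metrizable_space X"
  shows "cs_metrizable_space X"
proof -
  obtain M :: "(nat \<Rightarrow> 'a) topology" and f where "metrizable_space M"
    "f ` topspace M = topspace X" "precompact_proper_map M X f"
    using assms unfolding k_metrizable_space_def by blast
  then obtain D where D: "Metric_space (topspace X) D"
    and id: "continuous_map (Metric_space.mtopology (topspace X) D) X id"
    and lim: "\<And>\<sigma> y. range \<sigma> \<subseteq> topspace X \<Longrightarrow> limitin X \<sigma> y sequentially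
       \<Longrightarrow> limitin (Metric_space.mtopology (topspace X) D) \<sigma> y sequentially"
    using proper_image_sequential_metric[OF X] by metis
  interpret D: Metric_space "topspace X" D by (rule D)
  have "sequentially_continuous_fun X D.mtopology id"
    using lim by (auto simp: sequentially_continuous_fun_def convergent_seq_in_def)
  moreover have "section_of_map D.mtopology X id id"
    by (simp add: section_of_map_def)
  ultimately show ?thesis
    using cs_metrizable_spaceI[OF D.metrizable_space_mtopology id] by blast
qed

theorem proposition4p2:
  fixes X :: "'a topology"
  assumes "Hausdorff_space X"
  shows "(k_star_metrizable_space X \<longleftrightarrow>
            cs_star_metrizable_space X \<and>
            (\<forall>K. compactin X K \<longrightarrow> sequentially_compact_space (subtopology X K))) \<and>
         (k_metrizable_space X \<longleftrightarrow>
            cs_metrizable_space X \<and>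
            (\<forall>K. compactin X K \<longrightarrow> sequentially_compact_space (subtopology X K)))"
  using assms k_star_metrizable_imp_compact_imp_sequentially_compact
    k_star_metrizable_imp_cs_star_metrizable cs_star_metrizable_imp_k_star_metrizable
    k_metrizable_imp_k_star_metrizable k_metrizable_imp_cs_metrizable cs_metrizable_imp_k_metrizable
  by metis

end
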